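(* Let $G$ be a locally finite connected graph with polynomial growth of degree $d$, where $d\geq 2$ is an integer. Then $G$ satisfies the $O(n^{d-2})$-containment property.
   Context: For a vertex $g_0$, the growth function of $G$ based at $g_0$ is $\beta(n)=$ number of vertices at combinatorial distance at most $n$ from $g_0$. $G$ has polynomial growth of degree (at most) $d$ if there is a constant $c$ with $\beta(n)\le cn^d$ for all $n\ge1$ (independent of $g_0$ for connected locally finite graphs). Given a finite set $X_0$ of vertices, a sequence $\{W_k\}_{k\geq1}$ of vertex sets is an $\{f_n\}$-containment strategy for $X_0$ if: (1) $|W_n|\le f_n$ for all $n\ge1$; (2) $X_n\cap W_{n+1}=\emptyset$ for all $n\ge0$, where for $n>0$, $X_n$ is the set of vertices connected to a vertex of $X_{n-1}$ by a path of length at most $1$ containing no vertex of $W_1\cup\cdots\cup W_n$; (3) there is $N>0$ with $X_n=X_N$ for all $n\ge N$. $G$ has the $\{f_n\}$-containment property if every finite vertex set admits such a strategy; it has the $O(n^{k})$-containment property if it has the $\{f_n\}$-containment property for some non-negative integer sequence $\{f_n\}$ with $f_n=O(n^{k})$. *)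

theory Defs
  imports Graph_Theory.Digraph_Component Graph_Theory.Shortest_Path "HOL-Library.Landau_Symbols"
begin

text \<open>
  Following \<^theory>\<open>Graph_Theory.Digraph\<close>, an undirected graph is a symmetric digraph
  (\<^locale>\<open>sym_digraph\<close>); the vertex set may be infinite, and loops and parallel edges are
  allowed.
\<close>

definition locally_finite :: "('a, 'b) pre_digraph \<Rightarrow> bool" where
  "locally_finite G \<longleftrightarrow> (\<forall>v \<in> verts G. finite (out_arcs G v))"

text \<open>
  The combinatorial distance is the library's \<^const>\<open>wf_digraph.\<mu>\<close> (infimum of the costs of the
  walks from one vertex to another) for the weight function that is constantly 1.
\<close>

definition graph_distance :: "('a, 'b) pre_digraph \<Rightarrow> 'a \<Rightarrow> 'a \<Rightarrow> ereal" where
  "graph_distance G u v = wf_digraph.\<mu> G (\<lambda>_. 1) u v"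

text \<open>
  In a locally finite graph balls are finite, so \<^const>\<open>card\<close> is the true number of vertices
  (it would be 0 for an infinite ball).
\<close>

definition growth :: "('a, 'b) pre_digraph \<Rightarrow> 'a \<Rightarrow> nat \<Rightarrow> nat" where
  "growth G g\<^sub>0 n = card {v \<in> verts G. graph_distance G g\<^sub>0 v \<le> ereal (real n)}"

text \<open>
  Growth of degree at most \<open>d\<close>. For connected locally finite graphs the choice of the base vertex
  does not matter; one vertex with the required bound is enough.
\<close>

definition polynomial_growth :: "('a, 'b) pre_digraph \<Rightarrow> nat \<Rightarrow> bool" where
  "polynomial_growth G d \<longleftrightarrow>
     (\<exists>g\<^sub>0 \<in> verts G. \<exists>c :: real. \<forall>n \<ge> 1. real (growth G g\<^sub>0 n) \<le> c * real n ^ d)"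

text \<open>
  \<open>spread G X\<^sub>0 W n\<close> is the set \<open>X\<^sub>n\<close>. Sequences \<open>W\<close> and \<open>f\<close> are indexed from 1;
  their values at index 0 are never used. A path includes its first vertex, so that vertex must
  avoid \<open>W\<close> too.
\<close>

primrec spread :: "('a, 'b) pre_digraph \<Rightarrow> 'a set \<Rightarrow> (nat \<Rightarrow> 'a set) \<Rightarrow> nat \<Rightarrow> 'a set" where
  "spread G X\<^sub>0 W 0 = X\<^sub>0"
| "spread G X\<^sub>0 W (Suc n) =
     {v. \<exists>u \<in> spread G X\<^sub>0 W n. \<exists>p. pre_digraph.apath G u p v \<and> length p \<le> 1 \<and>
           set (pre_digraph.awalk_verts G u p) \<inter> (\<Union>i \<in> {1..Suc n}. W i) = {}}"

definition containment_strategy ::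
    "('a, 'b) pre_digraph \<Rightarrow> (nat \<Rightarrow> nat) \<Rightarrow> 'a set \<Rightarrow> (nat \<Rightarrow> 'a set) \<Rightarrow> bool" where
  "containment_strategy G f X\<^sub>0 W \<longleftrightarrow>
     (\<forall>n \<ge> 1. W n \<subseteq> verts G \<and> finite (W n) \<and> card (W n) \<le> f n) \<and>
     (\<forall>n. spread G X\<^sub>0 W n \<inter> W (n + 1) = {}) \<and>
     (\<exists>N > 0. \<forall>n \<ge> N. spread G X\<^sub>0 W n = spread G X\<^sub>0 W N)"

definition containment_property :: "('a, 'b) pre_digraph \<Rightarrow> (nat \<Rightarrow> nat) \<Rightarrow> bool" where
  "containment_property G f \<longleftrightarrow>
     (\<forall>X\<^sub>0. X\<^sub>0 \<subseteq> verts G \<and> finite X\<^sub>0 \<longrightarrow> (\<exists>W. containment_strategy G f X\<^sub>0 W))"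

definition bigo_containment_property :: "('a, 'b) pre_digraph \<Rightarrow> nat \<Rightarrow> bool" where
  "bigo_containment_property G k \<longleftrightarrow>
     (\<exists>f :: nat \<Rightarrow> nat. (\<lambda>n. real (f n)) \<in> O(\<lambda>n. real n ^ k) \<and> containment_property G f)"

end

theory Submission
  imports Defs
begin

text \<open>
  Fix a base vertex and a scale \<open>k\<close> whose ball \<open>B k\<close> contains the initial fire. Since
  \<open>|B (6k)|\<close> is \<open>O(k^d)\<close>, one of the \<open>3k\<close> spheres around radius \<open>3k\<close> to \<open>6k\<close> has only
  \<open>O(k^(d-1))\<close> vertices. The fire needs more than \<open>2k\<close> steps to reach that sphere, and at each of
  the times \<open>k + 1, \<dots>, 2k\<close> one may protect a constant times \<open>k^(d-2)\<close> vertices. So the sphere is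
  completely protected in time, and the fire stays in the finite ball that it encloses.
\<close>

section \<open>Balls in a locally finite graph\<close>

definition ball :: "('a, 'b) pre_digraph \<Rightarrow> 'a \<Rightarrow> nat \<Rightarrow> 'a set" where
  "ball G g n = {v \<in> verts G. graph_distance G g v \<le> ereal (real n)}"

lemma growth_eq_card_ball: "growth G g n = card (ball G g n)"
  by (simp add: growth_def ball_def)

lemma ball_mono: "m \<le> n \<Longrightarrow> ball G g m \<subseteq> ball G g n"
  unfolding ball_def by (auto elim: order_trans)

context wf_digraph
begin

lemma awalk_cost_one: "awalk_cost (\<lambda>_. 1) p = real (length p)"
  by (induct p) auto

lemma graph_distance_le_iff:
  "graph_distance G u v \<le> ereal (real n) \<longleftrightarrow> (\<exists>p. awalk u p v \<and> length p \<le> n)"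
proof
  assume "graph_distance G u v \<le> ereal (real n)"
  \<comment> \<open>An infimum need not be attained a priori, so the bound is relaxed to a strict
    one. Since lengths are integers, a walk of length below \<open>n + 1\<close> has length at most
    \<open>n\<close>.\<close>
  then have "\<mu> (\<lambda>_. 1) u v < ereal (real n + 1)"
    unfolding graph_distance_def by (rule order_le_less_trans) simp
  then obtain p where "awalk u p v" "real (length p) < real n + 1"
    by (auto simp: \<mu>_def INF_less_iff awalk_cost_one)
  then show "\<exists>p. awalk u p v \<and> length p \<le> n"
    by (intro exI[of _ p]) linarith
next
  assume "\<exists>p. awalk u p v \<and> length p \<le> n"
  then obtain p where "awalk u p v" "length p \<le> n" by blast
  then show "graph_distance G u v \<le> ereal (real n)"
    unfolding graph_distance_def
    using min_cost_le_walk_cost[of u p v "\<lambda>_. 1"]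
    by (auto simp: awalk_cost_one elim: order_trans)
qed

lemma in_ball_iff: "v \<in> ball G g n \<longleftrightarrow> (\<exists>p. awalk g p v \<and> length p \<le> n)"
  unfolding ball_def graph_distance_le_iff by auto

lemma ball_step:
  assumes "u \<in> ball G g n" "awalk u p v" "length p \<le> 1"
  shows "v \<in> ball G g (Suc n)"
proof -
  from assms(1) obtain q where "awalk g q u" "length q \<le> n"
    by (auto simp: in_ball_iff)
  with assms show ?thesis
    unfolding in_ball_iff by (intro exI[of _ "q @ p"]) auto
qed

text \<open>Removing the last arc shortens a walk by one; the empty walk has no last arc, hence the
  separate \<open>g\<close>. With local finiteness this gives finite balls by induction.\<close>

lemma ball_Suc_subset:
  "ball G g (Suc n) \<subseteq> insert g (\<Union>u\<in>ball G g n. head G ` out_arcs G u)"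
proof
  fix v assume "v \<in> ball G g (Suc n)"
  then obtain p where p: "awalk g p v" "length p \<le> Suc n"
    by (auto simp: in_ball_iff)
  show "v \<in> insert g (\<Union>u\<in>ball G g n. head G ` out_arcs G u)"
  proof (cases p rule: rev_cases)
    case Nil
    with p show ?thesis by (simp add: awalk_Nil_iff)
  next
    case (snoc q e)
    with p have "awalk g q (tail G e)" "e \<in> arcs G" "head G e = v" "length q \<le> n"
      by (auto simp: awalk_simps)
    then have "tail G e \<in> ball G g n" "e \<in> out_arcs G (tail G e)"
      by (auto simp: in_ball_iff)
    with \<open>head G e = v\<close> show ?thesis by blast
  qed
qed

lemma finite_ball:
  assumes "locally_finite G"
  shows "finite (ball G g n)"
proof (induct n)
  case 0
  have "ball G g 0 \<subseteq> {g}" by (auto simp: in_ball_iff awalk_Nil_iff)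
  then show ?case by (rule finite_subset) simp
next
  case (Suc n)
  have "finite (out_arcs G u)" if "u \<in> ball G g n" for u
    using that assms by (simp add: ball_def locally_finite_def)
  with Suc have "finite (insert g (\<Union>u\<in>ball G g n. head G ` out_arcs G u))"
    by simp
  with ball_Suc_subset show ?case by (rule finite_subset)
qed

lemma finite_subset_ball:
  assumes "strongly_connected G" "g \<in> verts G" "finite X" "X \<subseteq> verts G"
  shows "\<exists>r. X \<subseteq> ball G g r"
  using assms(3,4)
proof (induct X rule: finite_induct)
  case empty
  show ?case by simp
next
  case (insert x X)
  then obtain r where r: "X \<subseteq> ball G g r" by auto
  from assms(1,2) insert have "g \<rightarrow>\<^sup>* x" by auto
  then obtain p where "awalk g p x" by (auto simp: reachable_awalk)
  then have "x \<in> ball G g (length p)" by (auto simp: in_ball_iff)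
  then have "insert x X \<subseteq> ball G g (r + length p)"
    using r ball_mono[of r "r + length p" G g] ball_mono[of "length p" "r + length p" G g] by auto
  then show ?case ..
qed

end

section \<open>Counting in finite sets\<close>

text \<open>Pigeonhole: the \<open>m\<close> layers are disjoint subsets of
  \<open>B (a + m)\<close>, so they cannot all have \<open>q\<close> or more elements.\<close>

lemma thin_layer:
  fixes B :: "nat \<Rightarrow> 'a set"
  assumes "\<And>n. finite (B n)" "\<And>n. B n \<subseteq> B (Suc n)"
    and "card (B (a + m)) < m * q"
  shows "\<exists>R. a \<le> R \<and> R < a + m \<and> card (B (Suc R) - B R) < q"
proof (rule ccontr)
  assume "\<not> ?thesis"
  then have q: "q \<le> card (B (Suc R) - B R)" if "a \<le> R" "R < a + m" for R
    using that by (auto simp: not_less)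
  have "j * q \<le> card (B (a + j))" if "j \<le> m" for j
    using that
  proof (induct j)
    case (Suc j)
    have "card (B (Suc (a + j))) = card (B (a + j)) + card (B (Suc (a + j)) - B (a + j))"
      using assms(1,2) by (metis card_Diff_subset card_mono le_add_diff_inverse)
    with Suc q[of "a + j"] show ?case by simp
  qed simp
  from this[of m] assms(3) show False by simp
qed

text \<open>Enumerate \<open>S\<close> and cut the enumeration into consecutive runs of length
  \<open>q\<close>; the quotient by \<open>q\<close> numbers the runs. Each block will be protected
  at a single time.\<close>

lemma partition_into_blocks:
  fixes S :: "'a set"
  assumes "finite S" "card S \<le> q * k"
  obtains b :: "'a \<Rightarrow> nat"
  where "\<And>s. s \<in> S \<Longrightarrow> b s < k" "\<And>j. card {s \<in> S. b s = j} \<le> q"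
proof -
  from \<open>finite S\<close> obtain h where h: "bij_betw h S {0..<card S}"
    using ex_bij_betw_finite_nat by blast
  show thesis
  proof
    fix s assume "s \<in> S"
    with h have "h s < card S" by (auto simp: bij_betw_def)
    with assms(2) have "h s < k * q" by (simp add: mult.commute)
    then show "h s div q < k" by (rule less_mult_imp_div_less)
  next
    fix j
    show "card {s \<in> S. h s div q = j} \<le> q"
    proof (cases "q = 0")
      \<comment> \<open>Division by 0 yields 0 and would put all of \<open>S\<close> into one block,
        but here the size bound makes \<open>S\<close> empty.\<close>
      case True
      with assms show ?thesis by simp
    next
      case False
      have "card {s \<in> S. h s div q = j} \<le> card {j * q..<j * q + q}"
      proof (rule card_inj_on_le[of h])
        show "inj_on h {s \<in> S. h s div q = j}"
          using h by (auto simp: bij_betw_def intro: inj_on_subset)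
        have "n div q * q \<le> n" "n < n div q * q + q" for n
          using False dividend_less_div_times[of q n] by (auto simp: add.commute)
        then show "h ` {s \<in> S. h s div q = j} \<subseteq> {j * q..<j * q + q}"
          by auto
      qed simp
      then show ?thesis by simp
    qed
  qed
qed

text \<open>The cardinalities are bounded by that of \<open>A\<close>, so one of them is largest;
  from its index on, every inclusion is an equality.\<close>

lemma incseq_in_finite_set_stabilizes:
  fixes X :: "nat \<Rightarrow> 'a set"
  assumes "finite A" "\<And>n. X n \<subseteq> A" "\<And>n. X n \<subseteq> X (Suc n)"
  shows "\<exists>N>0. \<forall>n\<ge>N. X n = X N"
proof -
  have mono: "X m \<subseteq> X n" if "m \<le> n" for m n
    using assms(3) that by (rule lift_Suc_mono_le)
  have "\<forall>n. card (X n) < Suc (card A)"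
    using assms(1,2) by (simp add: card_mono less_Suc_eq_le)
  then obtain M where M: "card (X n) \<le> card (X M)" for n
    using ex_has_greatest_nat[of "\<lambda>_. True" 0 "\<lambda>n. card (X n)" "Suc (card A)"] by auto
  \<comment> \<open>\<open>Suc M\<close> instead of \<open>M\<close>, because the index must be
    positive.\<close>
  have "X n = X (Suc M)" if "Suc M \<le> n" for n
  proof -
    have "finite (X n)" using assms(1,2) by (rule rev_finite_subset)
    moreover have "X M \<subseteq> X (Suc M)" "X (Suc M) \<subseteq> X n" using mono that by auto
    ultimately show ?thesis using M[of n] by (metis card_seteq subset_antisym subset_trans)
  qed
  then show ?thesis by blast
qed

section \<open>Containment by protecting one sphere\<close>

text \<open>Up to time \<open>T\<close> the fire is too slow to leave the ball of radius
  \<open>R\<close>; from then on the sphere is fully protected, and a path of length at most 1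
  cannot jump over it.\<close>

lemma (in wf_digraph) sphere_containment_strategy:
  assumes "locally_finite G"
    and X\<^sub>0: "X\<^sub>0 \<subseteq> ball G g r"
    and R: "r + T \<le> R"
    and W: "\<And>n. n \<ge> 1 \<Longrightarrow> W n \<subseteq> ball G g (Suc R) - ball G g R"
    and card_W: "\<And>n. n \<ge> 1 \<Longrightarrow> card (W n) \<le> f n"
    and covered: "ball G g (Suc R) - ball G g R \<subseteq> (\<Union>i\<in>{1..T}. W i)"
  shows "containment_strategy G f X\<^sub>0 W"
proof -
  have spread_subset: "spread G X\<^sub>0 W n \<subseteq> ball G g R \<inter> ball G g (r + n)" for n
  proof (induct n)
    case 0
    with X\<^sub>0 R ball_mono[of r R G g] show ?case by auto
  next
    case (Suc n)
    show ?case
    proof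
      fix v assume "v \<in> spread G X\<^sub>0 W (Suc n)"
      then obtain u p where u: "u \<in> spread G X\<^sub>0 W n"
        and p: "apath u p v" "length p \<le> 1"
        and avoid: "set (awalk_verts u p) \<inter> (\<Union>i\<in>{1..Suc n}. W i) = {}"
        by auto
      from p have walk: "awalk u p v" by (auto intro: awalkI_apath)
      then have "v \<in> set (awalk_verts u p)" by auto
      with avoid have v: "v \<notin> (\<Union>i\<in>{1..Suc n}. W i)" by blast
      from u Suc have "u \<in> ball G g R" "u \<in> ball G g (r + n)" by auto
      with walk p have ball: "v \<in> ball G g (Suc R)" "v \<in> ball G g (Suc (r + n))"
        using ball_step by blast+
      have "v \<in> ball G g R"
      proof (cases "Suc n \<le> T")
        case True
        with R ball(2) ball_mono[of "Suc (r + n)" R G g] show ?thesis by auto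
      next
        case False
        then have "{1..T} \<subseteq> {1..Suc n}" by auto
        with v covered ball(1) show ?thesis by blast
      qed
      with ball(2) show "v \<in> ball G g R \<inter> ball G g (r + Suc n)" by simp
    qed
  qed
  have not_protected: "v \<notin> W i" if "v \<in> spread G X\<^sub>0 W n" "i \<ge> 1" for v n i
    using spread_subset[of n] W[of i] that by blast
  \<comment> \<open>A burning vertex keeps burning through the empty path. That path still contains
    the vertex itself, so \<open>not_protected\<close> is essential.\<close>
  have "spread G X\<^sub>0 W n \<subseteq> spread G X\<^sub>0 W (Suc n)" for n
  proof
    fix v assume v: "v \<in> spread G X\<^sub>0 W n"
    then have "v \<in> verts G" using spread_subset[of n] by (auto simp: ball_def)
    then have "apath v [] v" "set (awalk_verts v []) \<inter> (\<Union>i\<in>{1..Suc n}. W i) = {}"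
      using not_protected[OF v] by (auto simp: apath_Nil_iff)
    then have "\<exists>p. apath v p v \<and> length p \<le> 1 \<and>
        set (awalk_verts v p) \<inter> (\<Union>i\<in>{1..Suc n}. W i) = {}"
      by (intro exI[of _ "[]"]) simp
    with v show "v \<in> spread G X\<^sub>0 W (Suc n)"
      by (simp only: spread.simps) blast
  qed
  then have "\<exists>N>0. \<forall>n\<ge>N. spread G X\<^sub>0 W n = spread G X\<^sub>0 W N"
    using spread_subset finite_ball[OF assms(1), of g R]
    by (intro incseq_in_finite_set_stabilizes[of "ball G g R"]) auto
  moreover have "W n \<subseteq> verts G \<and> finite (W n) \<and> card (W n) \<le> f n" if "n \<ge> 1" for n
  proof -
    have "W n \<subseteq> ball G g (Suc R)" using W that by blast
    moreover have "ball G g (Suc R) \<subseteq> verts G" by (auto simp: ball_def)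
    ultimately show ?thesis
      using finite_ball[OF assms(1)] finite_subset card_W that by blast
  qed
  moreover have "spread G X\<^sub>0 W n \<inter> W (n + 1) = {}" for n
    using not_protected[of _ n "n + 1"] by auto
  ultimately show ?thesis unfolding containment_strategy_def by blast
qed

theorem theorem2p3:
  fixes G :: "('a, 'b) pre_digraph" and d :: nat
  assumes "sym_digraph G"
    and "locally_finite G"
    and "Digraph_Component.connected G"
    and "2 \<le> d"
    and "polynomial_growth G d"
  shows "bigo_containment_property G (d - 2)"
proof -
  interpret sym_digraph G by fact
  have conn: "strongly_connected G"
    using symmetric_connected_imp_strongly_connected[OF sym_arcs assms(3)] .
  from assms(5) obtain g c where g: "g \<in> verts G"
    and c: "\<And>n. n \<ge> 1 \<Longrightarrow> real (growth G g n) \<le> c * real n ^ d"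
    by (auto simp: polynomial_growth_def)
  \<comment> \<open>A natural constant, since \<open>f\<close> takes values in \<open>nat\<close>; a
    negative \<open>c\<close> becomes 0.\<close>
  define C where "C = nat \<lceil>c\<rceil>"
  have growth: "card (ball G g n) \<le> C * n ^ d" if "n \<ge> 1" for n
  proof -
    have "real (card (ball G g n)) \<le> c * real n ^ d"
      using c[OF that] by (simp add: growth_eq_card_ball)
    also have "\<dots> \<le> real C * real n ^ d"
      unfolding C_def by (intro mult_right_mono real_nat_ceiling_ge) simp
    also have "\<dots> = real (C * n ^ d)" by simp
    finally show ?thesis by linarith
  qed
  \<comment> \<open>The factor \<open>6 ^ d\<close> comes from the growth bound at radius
    \<open>6 * k\<close>; the extra 1 yields the strict inequality that \<open>thin_layer\<close>
    requires.\<close>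
  define K where "K = C * 6 ^ d + 1"
  define f where "f n = K * n ^ (d - 2)" for n
  have "(\<lambda>n. real (f n)) \<in> O(\<lambda>n. real n ^ (d - 2))"
    by (simp add: f_def)
  moreover have "\<exists>W. containment_strategy G f X\<^sub>0 W"
    if X\<^sub>0: "X\<^sub>0 \<subseteq> verts G" "finite X\<^sub>0" for X\<^sub>0
  proof -
    from finite_subset_ball[OF conn g X\<^sub>0(2,1)] obtain r where "X\<^sub>0 \<subseteq> ball G g r" ..
    \<comment> \<open>The successor makes \<open>k\<close> positive, as the growth bound and the
      strict estimate below demand.\<close>
    define k where "k = Suc r"
    have k: "k \<ge> 1" "X\<^sub>0 \<subseteq> ball G g k"
      using \<open>X\<^sub>0 \<subseteq> ball G g r\<close> ball_mono[of r k G g] by (auto simp: k_def)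
    have k_pow: "k ^ (d - 2) * k * k = k ^ d"
      using power_add[of k "d - 2" 2] le_add_diff_inverse2[OF \<open>2 \<le> d\<close>]
      by (simp only: power2_eq_square mult.assoc)
    have "card (ball G g (3 * k + 3 * k)) \<le> C * (6 * k) ^ d"
      using growth[of "6 * k"] k by simp
    also have "\<dots> < K * k ^ d"
      using k by (simp add: K_def power_mult_distrib)
    \<comment> \<open>\<open>f k * k\<close> is the number of vertices that can be protected in
      \<open>k\<close> steps with budget \<open>f k\<close>; it has order
      \<open>k ^ (d - 1)\<close>.\<close>
    also have "\<dots> = k * (f k * k)"
      by (simp add: f_def mult_ac flip: k_pow)
    also have "\<dots> \<le> 3 * k * (f k * k)" by simp
    finally obtain R where R: "3 * k \<le> R" "card (ball G g (Suc R) - ball G g R) < f k * k"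
      using thin_layer[of "ball G g" "3 * k" "3 * k" "f k * k"]
        finite_ball[OF assms(2)] ball_mono[of _ "Suc _" G g] by auto
    define S where "S = ball G g (Suc R) - ball G g R"
    have "finite S" unfolding S_def using finite_ball[OF assms(2)] by simp
    then obtain b where b: "\<And>s. s \<in> S \<Longrightarrow> b s < k" "\<And>j. card {s \<in> S. b s = j} \<le> f k"
      using partition_into_blocks[of S "f k" k] R by (auto simp: S_def)
    \<comment> \<open>Waiting until after time \<open>k\<close> makes every budget used at least
      \<open>f k\<close>. As \<open>b s < k\<close>, protection is complete by time
      \<open>2 * k\<close>, when a fire starting within radius \<open>k\<close> is still within
      radius \<open>3 * k\<close>; this is why the layers searched begin there.\<close>
    define W where "W n = {s \<in> S. n = Suc (k + b s)}" for n
    have "containment_strategy G f X\<^sub>0 W"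
    proof (rule sphere_containment_strategy[OF assms(2) k(2), of "2 * k"])
      show "k + 2 * k \<le> R" using R by simp
      show "W n \<subseteq> ball G g (Suc R) - ball G g R" for n
        by (auto simp: W_def S_def)
      show "ball G g (Suc R) - ball G g R \<subseteq> (\<Union>i\<in>{1..2 * k}. W i)"
        using b(1) by (fastforce simp: W_def S_def)
      show "card (W n) \<le> f n" for n
      proof (cases "n > k")
        case True
        then have "W n = {s \<in> S. b s = n - Suc k}" by (auto simp: W_def)
        then have "card (W n) \<le> f k" using b(2) by simp
        also have "f k \<le> f n" using True by (simp add: f_def power_mono)
        finally show ?thesis .
      next
        case False
        then have "W n = {}" by (auto simp: W_def)
        then show ?thesis by simp
      qed
    qed
    then show ?thesis by blast
  qed
  ultimately show ?thesis
    unfolding bigo_containment_property_def containment_property_def by blast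
qed

end
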